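(* Let $f:\mathbb{T}\to[0,1]$ be a Borel function with $\sigma:=\int_{\mathbb{T}} f\,d\mathfrak{m}\in(0,1)$, and let $(\xi_n)_{n\in\mathbb{Z}}$ be the $\{0,1\}$-valued random field of the determinantal point process on $\mathbb{Z}$ induced by the kernel $K_f(n,m)=\widehat{f}(n-m)$. For any complex sequence $a=(a_n)_{n\in\mathbb{Z}}\in\ell^2(\mathbb{Z})$, $$\left\|\sum_n a_n(\xi_n-\sigma)\right\|_2\le\sqrt{\sigma}\left(\sum_n|a_n|^2\right)^{1/2},$$ and the series $\sum_n a_n(\xi_n-\sigma)$ converges in $L^2$-mean. If $f$ is not an indicator function, we have the inverse inequality $$\left\|\sum_n a_n(\xi_n-\sigma)\right\|_2\ge c_f\left(\sum_n|a_n|^2\right)^{1/2}$$ for all $a\in\ell^2(\mathbb{Z})$, where $$c_f=\sqrt{\int_{\mathbb{T}} f(1-f)\,d\mathfrak{m}}>0.$$ (We have $c_f>0$ if and only if $f$ is not an indicator function.)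
   Context: $\mathbb{T}=\mathbb{R}/\mathbb{Z}$ with normalized Lebesgue measure $\mathfrak{m}$; $\widehat{f}(n)=\int_{\mathbb{T}} f(t)e^{-2\pi i n t}\,d\mathfrak{m}(t)$. The (stationary) determinantal point process induced by $K_f$ is the random subset $\mathfrak{X}=\mathfrak{X}(\omega)$ of $\mathbb{Z}$, defined on a probability space $(\Omega,\mathcal{A},\mathbb{P})$, whose indicator random variables $\xi_n(\omega)=1$ if $n\in\mathfrak{X}(\omega)$ and $\xi_n(\omega)=0$ otherwise satisfy, for all distinct $n_1,\dots,n_k\in\mathbb{Z}$, $\mathbb{E}(\xi_{n_1}\cdots\xi_{n_k})=\det(\widehat{f}(n_i-n_j))_{1\le i,j\le k}$. Such a process exists and its law is uniquely determined by $f$. $\|\cdot\|_2$ is the norm of $L^2(\Omega,\mathbb{P})$. "$f$ is an indicator function" means that $f$ coincides $\mathfrak{m}$-almost everywhere with the indicator function of a Borel subset of $\mathbb{T}$. *)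

theory Defs
  imports "HOL-Probability.Probability" "Jordan_Normal_Form.Determinant"
begin

text \<open>The circle \<open>\<real>/\<int>\<close> is represented by its fundamental domain \<open>[0,1)\<close>.  The projection
  \<open>[0,1) \<rightarrow> \<real>/\<int>\<close> is a Borel isomorphism which carries Lebesgue measure on \<open>[0,1)\<close> to normalized
  Lebesgue measure.  A function on the circle is a function on \<^typ>\<open>real\<close> whose values outside
  \<open>[0,1)\<close> are irrelevant.  The measure is not completed: its measurable sets are the Borel sets.\<close>

definition circle :: "real measure" where
  "circle = restrict_space lborel {0..<1}"

definition fourier_coeff :: "(real \<Rightarrow> real) \<Rightarrow> int \<Rightarrow> complex" where
  "fourier_coeff f n =
     (LINT t|circle. complex_of_real (f t) * exp (- 2 * of_real pi * \<i> * of_int n * of_real t))"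

definition toeplitz_kernel :: "(real \<Rightarrow> real) \<Rightarrow> int \<Rightarrow> int \<Rightarrow> complex" where
  "toeplitz_kernel f n m = fourier_coeff f (n - m)"

definition is_indicator_ae :: "(real \<Rightarrow> real) \<Rightarrow> bool" where
  "is_indicator_ae f \<longleftrightarrow> (\<exists>B\<in>sets circle. AE t in circle. f t = indicator B t)"

definition occupation :: "('o \<Rightarrow> int set) \<Rightarrow> int \<Rightarrow> 'o \<Rightarrow> real" where
  "occupation X n \<omega> = indicator (X \<omega>) n"

text \<open>A tuple of distinct integers is a distinct list.  The theory qualifiers select the matrices
  and determinants of \<open>Jordan_Normal_Form\<close>, whose dimension is a natural number.\<close>

definition determinantal_process ::
  "'o measure \<Rightarrow> (int \<Rightarrow> int \<Rightarrow> complex) \<Rightarrow> ('o \<Rightarrow> int set) \<Rightarrow> bool" where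
  "determinantal_process M K X \<longleftrightarrow>
     prob_space M \<and>
     (\<forall>n. occupation X n \<in> borel_measurable M) \<and>
     (\<forall>ns. distinct ns \<longrightarrow>
        complex_of_real (LINT \<omega>|M. (\<Prod>i<length ns. occupation X (ns ! i) \<omega>)) =
        Determinant.det (Matrix.mat (length ns) (length ns) (\<lambda>(i, j). K (ns ! i) (ns ! j))))"

definition in_L2 :: "'o measure \<Rightarrow> ('o \<Rightarrow> complex) \<Rightarrow> bool" where
  "in_L2 M g \<longleftrightarrow> g \<in> borel_measurable M \<and> integrable M (\<lambda>\<omega>. (cmod (g \<omega>))\<^sup>2)"

text \<open>Only meaningful for \<^term>\<open>g\<close> with \<^term>\<open>in_L2 M g\<close>: the integral of a non-integrable
  function is 0.\<close>

definition L2_norm :: "'o measure \<Rightarrow> ('o \<Rightarrow> complex) \<Rightarrow> real" where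
  "L2_norm M g = sqrt (LINT \<omega>|M. (cmod (g \<omega>))\<^sup>2)"

text \<open>Convergence in \<open>L\<^sup>2\<close>-mean of a series indexed by the integers, along the net of finite
  subsets as for \<^const>\<open>has_sum\<close>; this contains convergence of the symmetric partial sums.
  The sum \<^term>\<open>S\<close> is determined up to null sets.\<close>

definition has_L2_sum :: "'o measure \<Rightarrow> (int \<Rightarrow> 'o \<Rightarrow> complex) \<Rightarrow> ('o \<Rightarrow> complex) \<Rightarrow> bool" where
  "has_L2_sum M g S \<longleftrightarrow>
     (\<forall>n. in_L2 M (g n)) \<and> in_L2 M S \<and>
     ((\<lambda>F. L2_norm M (\<lambda>\<omega>. (\<Sum>n\<in>F. g n \<omega>) - S \<omega>)) \<longlongrightarrow> 0) (finite_subsets_at_top UNIV)"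

definition ell2 :: "(int \<Rightarrow> complex) set" where
  "ell2 = {a. (\<lambda>n. (cmod (a n))\<^sup>2) summable_on UNIV}"

definition ell2_norm :: "(int \<Rightarrow> complex) \<Rightarrow> real" where
  "ell2_norm a = sqrt (\<Sum>\<^sub>\<infinity>n. (cmod (a n))\<^sup>2)"

definition lower_const :: "(real \<Rightarrow> real) \<Rightarrow> real" where
  "lower_const f = sqrt (LINT t|circle. f t * (1 - f t))"

end

theory Submission
  imports Defs
begin

text \<open>For a finitely supported \<open>a\<close> the determinantal formula for one and two points gives
  \<open>\<parallel>\<Sum> a\<^sub>n (\<xi>\<^sub>n - \<sigma>)\<parallel>\<^sup>2 = \<sigma> \<Sum> \<bar>a\<^sub>n\<bar>\<^sup>2 - q\<close>, where \<open>q\<close> is the quadratic form with matrix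
  \<open>\<bar>fourier_coeff f (n - m)\<bar>\<^sup>2\<close>.  Since these are the Fourier coefficients of the autocorrelation of \<open>f\<close>, the form
  \<open>q\<close> is the double integral of \<open>f(s) f(t) \<bar>A(s - t)\<bar>\<^sup>2\<close> for the trigonometric polynomial \<open>A\<close> with
  coefficients \<open>a\<close>.  Hence \<open>q \<ge> 0\<close>, and \<open>2 f(s) f(t) \<le> f(s)\<^sup>2 + f(t)\<^sup>2\<close> together with Parseval's
  identity gives \<open>q \<le> (\<integral> f\<^sup>2) \<Sum> \<bar>a\<^sub>n\<bar>\<^sup>2\<close>.  Both bounds pass to the limit along finite sets, the
  upper one providing the Cauchy property.\<close>

section \<open>Determinants of order two and integrals of separated products\<close>

lemma det_mat_2:
  fixes k :: "nat \<Rightarrow> nat \<Rightarrow> 'a :: comm_ring_1"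
  shows "Determinant.det (Matrix.mat 2 2 (\<lambda>(i, j). k i j)) = k 0 0 * k 1 1 - k 0 1 * k 1 0"
proof -
  let ?A = "Matrix.mat 2 2 (\<lambda>(i, j). k i j)"
  have A: "?A \<in> carrier_mat 2 2" by simp
  have "Determinant.det ?A = (\<Sum>i<2. ?A $$ (i, 0) * cofactor ?A i 0)"
    by (rule laplace_expansion_column[OF A]) simp
  also have "\<dots> = k 0 0 * k 1 1 - k 0 1 * k 1 0"
    by (simp add: numeral_2_eq_2 cofactor_def mat_delete_def det_single)
  finally show ?thesis .
qed

text \<open>Each term of the expanded quadratic form has separated variables; its double integral
  then factors into two Fourier coefficients.\<close>

lemma (in pair_sigma_finite) integral_times:
  fixes u :: "'a \<Rightarrow> complex" and v :: "'b \<Rightarrow> complex"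
  assumes u: "integrable M1 u" and v: "integrable M2 v"
  shows integrable_times: "integrable (M1 \<Otimes>\<^sub>M M2) (\<lambda>p. u (fst p) * v (snd p))"
    and integral_times_eq:
      "(LINT p|(M1 \<Otimes>\<^sub>M M2). u (fst p) * v (snd p)) = integral\<^sup>L M1 u * integral\<^sup>L M2 v"
proof -
  have [measurable]: "u \<in> borel_measurable M1" "v \<in> borel_measurable M2"
    using u v by auto
  show *: "integrable (M1 \<Otimes>\<^sub>M M2) (\<lambda>p. u (fst p) * v (snd p))"
    by (rule Fubini_integrable) (use u v in \<open>auto simp: norm_mult\<close>)
  show "(LINT p|(M1 \<Otimes>\<^sub>M M2). u (fst p) * v (snd p)) = integral\<^sup>L M1 u * integral\<^sup>L M2 v"
    using integral_fst'[OF *] by simp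
qed

section \<open>Characters and Fourier coefficients on the circle\<close>

interpretation circle: prob_space circle
  by standard (simp add: circle_def emeasure_restrict_space space_restrict_space)

interpretation circle_pair: pair_prob_space circle circle ..

lemma integrable_circle_bounded:
  fixes u :: "real \<Rightarrow> 'b :: {banach, second_countable_topology}"
  assumes "u \<in> borel_measurable circle" "\<And>t. t \<in> space circle \<Longrightarrow> norm (u t) \<le> B"
  shows "integrable circle u"
  by (rule circle.integrable_const_bound[where B = B]) (use assms in auto)

text \<open>Taking all of \<open>real\<close> as domain lets a difference \<open>s - t\<close> of
  two points be inserted without reduction modulo 1. With \<open>cis\<close>, products and
  conjugates of characters become sums and negatives of angles.\<close>

definition circle_char :: "int \<Rightarrow> real \<Rightarrow> complex" where
  "circle_char n t = cis (2 * pi * of_int n * t)"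

lemma measurable_circle_char [measurable]: "circle_char n \<in> borel_measurable borel"
  unfolding circle_char_def by (intro borel_measurable_continuous_onI continuous_intros)

lemma measurable_circle_char' [measurable]: "circle_char n \<in> borel_measurable circle"
  unfolding circle_def by (intro measurable_restrict_space1) simp

lemma norm_circle_char [simp]: "norm (circle_char n t) = 1"
  by (simp add: circle_char_def)

lemma circle_char_0 [simp]: "circle_char 0 t = 1"
  by (simp add: circle_char_def)

text \<open>The left side depends on \<open>n - m\<close> alone, and the exponential of a difference
  separates \<open>s\<close> from \<open>t\<close>. The signs are those in
  \<open>fourier_coeff_eq\<close>, so integration against \<open>g\<close> and \<open>h\<close>
  gives coefficients at \<open>n - m\<close> and \<open>m - n\<close>.\<close>

lemma circle_char_diff_mult_cnj:
  "circle_char (- n) (s - t) * cnj (circle_char (- m) (s - t)) =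
     circle_char (- (n - m)) s * circle_char (- (m - n)) t"
  by (simp add: circle_char_def cis_cnj cis_mult algebra_simps)

lemma fourier_coeff_eq: "fourier_coeff f n = (LINT t|circle. of_real (f t) * circle_char (- n) t)"
  unfolding fourier_coeff_def circle_char_def cis_conv_exp
  by (intro Bochner_Integration.integral_cong) (auto simp: algebra_simps)

text \<open>For nonzero \<open>n\<close> the antiderivative \<open>F\<close> has period 1, so its
  increment over the unit interval vanishes.\<close>

lemma integral_circle_char: "integral\<^sup>L circle (circle_char n) = (if n = 0 then 1 else 0)"
proof (cases "n = 0")
  case True
  then have "circle_char n = (\<lambda>_. 1)" by (simp add: fun_eq_iff)
  with True show ?thesis by (simp add: circle.prob_space)
next
  case False
  define F where "F t = circle_char n t / (2 * pi * \<i> * of_int n)" for t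
  have "integral\<^sup>L circle (circle_char n) = (LBINT t:{0..<1}. circle_char n t)"
    unfolding circle_def set_lebesgue_integral_def by (rule integral_restrict_space) auto
  also have "\<dots> = (LBINT t=0..1. circle_char n t)"
    using interval_integral_Ico[of 0 1 "circle_char n"] by (simp add: zero_ereal_def one_ereal_def)
  also have "\<dots> = F 1 - F 0"
  proof -
    have "(LBINT t=ereal 0..ereal 1. circle_char n t) = F 1 - F 0"
    proof (rule interval_integral_FTC_finite)
      show "continuous_on {min 0 1..max 0 1} (circle_char n)"
        unfolding circle_char_def by (intro continuous_intros)
      show "(F has_vector_derivative circle_char n x) (at x within {min 0 1..max 0 1})" for x
        unfolding F_def circle_char_def has_vector_derivative_def
        by (rule derivative_eq_intros refl | simp add: False)+
          (use False in \<open>auto simp: fun_eq_iff scaleR_conv_of_real field_simps\<close>)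
    qed
    then show ?thesis by (simp add: zero_ereal_def one_ereal_def)
  qed
  also have "\<dots> = 0"
    using cis_multiple_2pi[of "of_int n"] by (simp add: F_def circle_char_def)
  finally show ?thesis using False by simp
qed

lemma fourier_coeff_1: "fourier_coeff (\<lambda>_. 1) n = (if n = 0 then 1 else 0)"
  by (simp add: fourier_coeff_eq integral_circle_char)

lemma fourier_coeff_0: "fourier_coeff f 0 = of_real (LINT t|circle. f t)"
  by (simp add: fourier_coeff_eq)

text \<open>Expanding the squared modulus and separating variables turns the double integral into a
  double sum of products of coefficients. Two functions are allowed because three pairs occur later:
  \<open>f\<close> with \<open>f\<close> gives the quadratic form of the process, while the square
  of \<open>f\<close> paired with 1, in either order, gives Parseval's identity.\<close>

lemma fourier_quadratic_form:
  fixes g h :: "real \<Rightarrow> real" and b :: "int \<Rightarrow> complex"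
  defines "P \<equiv> \<lambda>F u. (cmod (\<Sum>n\<in>F. b n * circle_char (- n) u))\<^sup>2"
  assumes g: "g \<in> borel_measurable circle" "\<And>t. t \<in> space circle \<Longrightarrow> \<bar>g t\<bar> \<le> 1"
    and h: "h \<in> borel_measurable circle" "\<And>t. t \<in> space circle \<Longrightarrow> \<bar>h t\<bar> \<le> 1"
  shows fourier_quadratic_form_integrable:
      "integrable (circle \<Otimes>\<^sub>M circle) (\<lambda>p. g (fst p) * h (snd p) * P F (fst p - snd p))" (is ?int)
    and fourier_quadratic_form_integral:
      "of_real (LINT p|(circle \<Otimes>\<^sub>M circle). g (fst p) * h (snd p) * P F (fst p - snd p)) =
       (\<Sum>n\<in>F. \<Sum>m\<in>F. b n * cnj (b m) * (fourier_coeff g (n - m) * fourier_coeff h (m - n)))"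
      (is ?eq)
proof -
  note [measurable] = g(1) h(1)
  define w where "w n m p = (of_real (g (fst p)) * circle_char (- (n - m)) (fst p)) *
      (of_real (h (snd p)) * circle_char (- (m - n)) (snd p))" for n m and p :: "real \<times> real"
  have ig: "integrable circle (\<lambda>t. of_real (g t) * circle_char n t)" for n
    by (rule integrable_circle_bounded[where B = 1]) (auto simp: norm_mult g)
  have ih: "integrable circle (\<lambda>t. of_real (h t) * circle_char n t)" for n
    by (rule integrable_circle_bounded[where B = 1]) (auto simp: norm_mult h)
  have iw: "integrable (circle \<Otimes>\<^sub>M circle) (w n m)" for n m
    unfolding w_def by (rule circle_pair.integrable_times[OF ig ih])
  have sw: "integral\<^sup>L (circle \<Otimes>\<^sub>M circle) (w n m) =
      fourier_coeff g (n - m) * fourier_coeff h (m - n)" for n m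
    unfolding w_def fourier_coeff_eq by (rule circle_pair.integral_times_eq[OF ig ih])
  have eq: "of_real (g (fst p) * h (snd p) * P F (fst p - snd p)) =
      (\<Sum>n\<in>F. \<Sum>m\<in>F. b n * cnj (b m) * w n m p)" for p
  proof -
    have "of_real (P F (fst p - snd p)) =
      (\<Sum>n\<in>F. \<Sum>m\<in>F. b n * cnj (b m) * (circle_char (- n) (fst p - snd p) *
         cnj (circle_char (- m) (fst p - snd p))))"
      unfolding P_def complex_norm_square
      by (simp add: sum_product mult_ac)
    then show ?thesis
      unfolding circle_char_diff_mult_cnj w_def by (simp add: sum_distrib_left mult_ac)
  qed
  \<comment> \<open>The integrand inherits integrability from its expansion into the terms
    \<open>w n m\<close>.\<close>
  have isum: "integrable (circle \<Otimes>\<^sub>M circle)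
      (\<lambda>p. of_real (g (fst p) * h (snd p) * P F (fst p - snd p)) :: complex)"
    unfolding eq using iw by auto
  from integrable_Re[OF this] show ?int by simp
  show ?eq
    unfolding integral_complex_of_real[symmetric] eq using iw by (simp add: sw)
qed

section \<open>The norm of square-integrable functions\<close>

text \<open>Minkowski's inequality comes from integrating the weighted pointwise bound
  \<open>le\<close>, itself a rearrangement of a nonnegative square. If the norms are at most
  \<open>s\<close> and \<open>t\<close>, the weights combine to exactly the square of
  \<open>s + t\<close>.\<close>

lemma L2_triangle:
  assumes g: "in_L2 M g" and h: "in_L2 M h"
  shows in_L2_add: "in_L2 M (\<lambda>x. g x + h x)"
    and L2_norm_add: "L2_norm M (\<lambda>x. g x + h x) \<le> L2_norm M g + L2_norm M h"
proof -
  have [measurable]: "g \<in> borel_measurable M" "h \<in> borel_measurable M"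
    and ig: "integrable M (\<lambda>x. (cmod (g x))\<^sup>2)" and ih: "integrable M (\<lambda>x. (cmod (h x))\<^sup>2)"
    using g h by (auto simp: in_L2_def)
  \<comment> \<open>Optimal for \<open>s\<close> and \<open>t\<close> equal to the two norms; they are perturbed below, since these may vanish.\<close>
  have le: "(cmod (g x + h x))\<^sup>2 \<le> (1 + t / s) * (cmod (g x))\<^sup>2 + (1 + s / t) * (cmod (h x))\<^sup>2"
    if "s > 0" "t > 0" for s t x
  proof -
    have "(cmod (g x + h x))\<^sup>2 \<le> (cmod (g x) + cmod (h x))\<^sup>2"
      by (intro power_mono norm_triangle_ineq) auto
    moreover have "(t * cmod (g x) - s * cmod (h x))\<^sup>2 / (s * t) =
        t / s * (cmod (g x))\<^sup>2 + s / t * (cmod (h x))\<^sup>2 - 2 * cmod (g x) * cmod (h x)"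
      using that by (simp add: power2_eq_square field_simps)
    moreover have "0 \<le> (t * cmod (g x) - s * cmod (h x))\<^sup>2 / (s * t)"
      using that by simp
    ultimately show ?thesis by (simp add: power2_sum algebra_simps)
  qed
  have "integrable M (\<lambda>x. (cmod (g x + h x))\<^sup>2)"
    by (rule Bochner_Integration.integrable_bound[of _ "\<lambda>x. 2 * (cmod (g x))\<^sup>2 + 2 * (cmod (h x))\<^sup>2"])
      (use le[of 1 1] ig ih in auto)
  then show gh: "in_L2 M (\<lambda>x. g x + h x)" by (simp add: in_L2_def)
  show "L2_norm M (\<lambda>x. g x + h x) \<le> L2_norm M g + L2_norm M h"
  proof (rule field_le_epsilon)
    fix e :: real assume "e > 0"
    define s t where "s = L2_norm M g + e / 2" and "t = L2_norm M h + e / 2"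
    have nn: "L2_norm M g \<ge> 0" "L2_norm M h \<ge> 0" by (auto simp: L2_norm_def)
    then have st: "s > 0" "t > 0" using \<open>e > 0\<close> by (auto simp: s_def t_def)
    have "(LINT x|M. (cmod (g x + h x))\<^sup>2) \<le>
        (LINT x|M. (1 + t / s) * (cmod (g x))\<^sup>2 + (1 + s / t) * (cmod (h x))\<^sup>2)"
      using gh ig ih le[OF st] by (intro integral_mono) (auto simp: in_L2_def)
    also have "\<dots> = (1 + t / s) * (L2_norm M g)\<^sup>2 + (1 + s / t) * (L2_norm M h)\<^sup>2"
      using ig ih by (simp add: L2_norm_def)
    also have "\<dots> \<le> (1 + t / s) * s\<^sup>2 + (1 + s / t) * t\<^sup>2"
      using st nn \<open>e > 0\<close> by (intro add_mono mult_left_mono power_mono) (auto simp: s_def t_def)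
    also have "\<dots> = (s + t)\<^sup>2"
      using st by (simp add: power2_eq_square field_simps)
    finally have "L2_norm M (\<lambda>x. g x + h x) \<le> s + t"
      unfolding L2_norm_def using st by (intro real_le_lsqrt) auto
    then show "L2_norm M (\<lambda>x. g x + h x) \<le> L2_norm M g + L2_norm M h + e"
      by (simp add: s_def t_def)
  qed
qed

lemma in_L2_uminus: "in_L2 M g \<Longrightarrow> in_L2 M (\<lambda>x. - g x)"
  by (simp add: in_L2_def)

lemma in_L2_diff:
  assumes "in_L2 M g" "in_L2 M h"
  shows "in_L2 M (\<lambda>x. g x - h x)"
  using in_L2_add[OF assms(1) in_L2_uminus[OF assms(2)]] by simp

lemma L2_norm_minus_commute: "L2_norm M (\<lambda>x. g x - h x) = L2_norm M (\<lambda>x. h x - g x)"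
  by (simp add: L2_norm_def norm_minus_commute)

lemma L2_norm_diff:
  assumes "in_L2 M g" "in_L2 M h"
  shows "L2_norm M (\<lambda>x. g x - h x) \<le> L2_norm M g + L2_norm M h"
  using L2_norm_add[OF assms(1) in_L2_uminus[OF assms(2)]] by (simp add: L2_norm_def)

lemma abs_L2_norm_diff:
  assumes "in_L2 M g" "in_L2 M h"
  shows "\<bar>L2_norm M g - L2_norm M h\<bar> \<le> L2_norm M (\<lambda>x. g x - h x)"
  using L2_norm_add[OF in_L2_diff[OF assms] assms(2)]
    L2_norm_add[OF in_L2_diff[OF assms(2,1)] assms(1)]
  by (simp add: L2_norm_minus_commute[of M h g])

lemma in_L2_sum:
  assumes "\<And>n. n \<in> F \<Longrightarrow> in_L2 M (g n)"
  shows "in_L2 M (\<lambda>x. \<Sum>n\<in>F. g n x)"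
  using assms
proof (induction F rule: infinite_finite_induct)
  case (insert n F)
  then show ?case using in_L2_add[of M "g n" "\<lambda>x. \<Sum>n\<in>F. g n x"] by simp
qed (simp_all add: in_L2_def)

text \<open>This is nonnegativity of the variance of the modulus of \<open>g\<close>. It turns
  Cauchy estimates in mean square into Cauchy estimates in mean, from which an almost everywhere
  Cauchy subsequence is extracted.\<close>

lemma (in prob_space) L1_le_L2_norm:
  assumes "in_L2 M g"
  shows "integrable M g" "(LINT x|M. norm (g x)) \<le> L2_norm M g"
proof -
  have [measurable]: "g \<in> borel_measurable M" and i2: "integrable M (\<lambda>x. (cmod (g x))\<^sup>2)"
    using assms by (auto simp: in_L2_def)
  show i1: "integrable M g"
    using square_integrable_imp_integrable[of "\<lambda>x. norm (g x)"] i2 by (simp add: integrable_norm_iff)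
  have "0 \<le> variance (\<lambda>x. norm (g x))" by (rule variance_positive)
  also have "\<dots> = expectation (\<lambda>x. (norm (g x))\<^sup>2) - (expectation (\<lambda>x. norm (g x)))\<^sup>2"
    using i1 i2 by (intro variance_eq) auto
  finally show "(LINT x|M. norm (g x)) \<le> L2_norm M g"
    unfolding L2_norm_def by (intro real_le_rsqrt) simp
qed


section \<open>Convergence in mean square along finite sets\<close>

text \<open>The sums over \<open>F0\<close> and over \<open>F0\<close> joined with \<open>G\<close>
  both lie within \<open>e / 2\<close> of the limit, and they differ by the sum over
  \<open>G\<close>.\<close>

lemma summable_on_Cauchy_tail:
  fixes w :: "'i \<Rightarrow> real"
  assumes "w summable_on UNIV" "e > 0"
  obtains F0 where "finite F0" "\<And>G. finite G \<Longrightarrow> G \<inter> F0 = {} \<Longrightarrow> sum w G < e"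
proof -
  have "(sum w \<longlongrightarrow> infsum w UNIV) (finite_subsets_at_top UNIV)"
    using has_sum_infsum[OF assms(1)] by (simp add: has_sum_def)
  then have "\<forall>\<^sub>F F in finite_subsets_at_top UNIV. dist (sum w F) (infsum w UNIV) < e / 2"
    using \<open>e > 0\<close> by (intro tendstoD) auto
  then obtain F0 where F0: "finite F0"
    "\<And>F. finite F \<Longrightarrow> F0 \<subseteq> F \<Longrightarrow> dist (sum w F) (infsum w UNIV) < e / 2"
    unfolding eventually_finite_subsets_at_top by auto
  show thesis
  proof (rule that[OF F0(1)])
    fix G assume G: "finite G" "G \<inter> F0 = {}"
    have "sum w (F0 \<union> G) = sum w F0 + sum w G"
      using F0(1) G by (intro sum.union_disjoint) auto
    with F0(2)[of "F0 \<union> G"] F0(2)[of F0] F0(1) G show "sum w G < e"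
      by (auto simp: dist_real_def abs_if split: if_splits)
  qed
qed

text \<open>A Riesz-Fischer argument: the finite sums are Cauchy, a subsequence along symmetric
  intervals converges almost everywhere, and Fatou's lemma carries the Cauchy estimate over to its
  limit.\<close>

lemma (in prob_space) has_L2_sum_exists:
  fixes g :: "int \<Rightarrow> 'a \<Rightarrow> complex" and w :: "int \<Rightarrow> real"
  assumes g: "\<And>n. in_L2 M (g n)" and w: "w summable_on UNIV"
    and le: "\<And>F. finite F \<Longrightarrow> L2_norm M (\<lambda>x. \<Sum>n\<in>F. g n x) \<le> sqrt (sum w F)"
  shows "\<exists>S. has_L2_sum M g S"
proof -
  define T where "T F x = (\<Sum>n\<in>F. g n x)" for F x
  have T: "in_L2 M (T F)" for F
    unfolding T_def using g by (intro in_L2_sum) auto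
  have T_meas [measurable]: "T F \<in> borel_measurable M" for F
    using T by (simp add: in_L2_def)
  have cauchy: "\<exists>F0. finite F0 \<and> (\<forall>F G. finite F \<longrightarrow> finite G \<longrightarrow> F0 \<subseteq> F \<longrightarrow> F0 \<subseteq> G \<longrightarrow>
      L2_norm M (\<lambda>x. T F x - T G x) < e)" if e: "e > 0" for e
  proof -
    \<comment> \<open>The square compensates for the root in \<open>le\<close>. Thirds leave room
      for a strict final inequality, as \<open>small\<close> is not strict.\<close>
    obtain F0 where F0: "finite F0"
      "\<And>G. finite G \<Longrightarrow> G \<inter> F0 = {} \<Longrightarrow> sum w G < (e / 3)\<^sup>2"
      using summable_on_Cauchy_tail[OF w, of "(e / 3)\<^sup>2"] e by auto
    have small: "L2_norm M (T G) \<le> e / 3" if "finite G" "G \<inter> F0 = {}" for G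
    proof -
      have "L2_norm M (T G) \<le> sqrt (sum w G)" unfolding T_def by (rule le) fact
      also have "\<dots> \<le> sqrt ((e / 3)\<^sup>2)" using F0(2)[OF that] by (intro real_sqrt_le_mono) simp
      finally show ?thesis using e by simp
    qed
    have "L2_norm M (\<lambda>x. T F x - T G x) < e"
      if FG: "finite F" "finite G" "F0 \<subseteq> F" "F0 \<subseteq> G" for F G
    proof -
      \<comment> \<open>The common part of \<open>F\<close> and \<open>G\<close> cancels in the
        difference; what remains are sums over two sets that avoid \<open>F0\<close>.\<close>
      have split: "T F' x = T (F' - G') x + T (F' \<inter> G') x" if "finite F'" for F' G' :: "int set" and x
        unfolding T_def using that by (subst sum.union_disjoint[symmetric]) (auto intro!: sum.cong)
      have "T F x - T G x = T (F - G) x - T (G - F) x" for x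
        using split[of F x G] split[of G x F] FG by (simp add: Int_commute)
      then have "L2_norm M (\<lambda>x. T F x - T G x) \<le> L2_norm M (T (F - G)) + L2_norm M (T (G - F))"
        using L2_norm_diff[OF T T] by presburger
      also have "\<dots> \<le> e / 3 + e / 3"
        using FG by (intro add_mono small) auto
      finally show ?thesis using e by simp
    qed
    with F0(1) show ?thesis by blast
  qed

  \<comment> \<open>The symmetric intervals form a cofinal sequence of finite sets, replacing the
    net by a sequence to which subsequence extraction and Fatou's lemma apply.\<close>
  define box where "box k = {- int k..int k}" for k
  have box: "\<exists>N. \<forall>k\<ge>N. F0 \<subseteq> box k" if F0: "finite F0" for F0
  proof -
    have "bdd_above ((\<lambda>n. nat \<bar>n\<bar>) ` F0)" using F0 by simp
    then obtain N where "\<And>n. n \<in> F0 \<Longrightarrow> nat \<bar>n\<bar> \<le> N" by (auto simp: bdd_above_def)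
    then have "F0 \<subseteq> box k" if "k \<ge> N" for k
      using that by (fastforce simp: box_def)
    then show ?thesis by blast
  qed
  obtain r where r: "strict_mono r" "AE x in M. Cauchy (\<lambda>k. T (box (r k)) x)"
  proof (rule cauchy_L1_AE_cauchy_subseq[of M "\<lambda>k. T (box k)"])
    show "integrable M (T (box k))" for k using T by (rule L1_le_L2_norm)
    fix e :: real assume "e > 0"
    from cauchy[OF this] obtain F0 where F0: "finite F0"
      "\<And>F G. finite F \<Longrightarrow> finite G \<Longrightarrow> F0 \<subseteq> F \<Longrightarrow> F0 \<subseteq> G \<Longrightarrow> L2_norm M (\<lambda>x. T F x - T G x) < e"
      by blast
    from box[OF F0(1)] obtain N where N: "\<And>k. k \<ge> N \<Longrightarrow> F0 \<subseteq> box k" by blast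
    have "(LINT x|M. norm (T (box i) x - T (box j) x)) < e" if "i \<ge> N" "j \<ge> N" for i j
      using L1_le_L2_norm(2)[OF in_L2_diff[OF T T], of "box i" "box j"]
        F0(2)[of "box i" "box j"] N[OF that(1)] N[OF that(2)]
      by (simp add: box_def)
    then show "\<exists>N. \<forall>i\<ge>N. \<forall>j\<ge>N. (LINT x|M. norm (T (box i) x - T (box j) x)) < e" by blast
  qed auto

  \<comment> \<open>On the null set where the sequence diverges \<open>lim\<close> is unspecified,
    but \<open>S\<close> is still measurable.\<close>
  define S where "S x = lim (\<lambda>k. T (box (r k)) x)" for x
  have [measurable]: "S \<in> borel_measurable M"
    unfolding S_def by (rule borel_measurable_lim_metric) simp
  have S: "AE x in M. (\<lambda>k. T (box (r k)) x) \<longlonglongrightarrow> S x"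
    using r(2) by eventually_elim (simp add: S_def Cauchy_convergent_iff convergent_LIMSEQ_iff)
  \<comment> \<open>Square integrability is part of the claim: without it \<open>L2_norm\<close>
    would be 0 by default and the bound would say nothing. It also yields \<open>in_L2 M S\<close>
    below.\<close>
  have close: "\<exists>F0. finite F0 \<and> (\<forall>F. finite F \<longrightarrow> F0 \<subseteq> F \<longrightarrow>
      in_L2 M (\<lambda>x. T F x - S x) \<and> L2_norm M (\<lambda>x. T F x - S x) \<le> e)" if e: "e > 0" for e
  proof -
    from cauchy[OF e] obtain F0 where F0: "finite F0"
      "\<And>F G. finite F \<Longrightarrow> finite G \<Longrightarrow> F0 \<subseteq> F \<Longrightarrow> F0 \<subseteq> G \<Longrightarrow> L2_norm M (\<lambda>x. T F x - T G x) < e"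
      by blast
    from box[OF F0(1)] obtain N where N: "\<And>k. k \<ge> N \<Longrightarrow> F0 \<subseteq> box k" by blast
    have "in_L2 M (\<lambda>x. T F x - S x) \<and> L2_norm M (\<lambda>x. T F x - S x) \<le> e"
      if F: "finite F" "F0 \<subseteq> F" for F
    proof -
      define u where "u k x = ennreal ((cmod (T F x - T (box (r k)) x))\<^sup>2)" for k x
      have [measurable]: "u k \<in> borel_measurable M" for k unfolding u_def by simp
      \<comment> \<open>Fatou's lemma is applied with \<open>F\<close> fixed while the interval
        grows; nonnegative integrals are used since integrability of the limit is not yet
        known.\<close>
      have "(\<integral>\<^sup>+x. ennreal ((cmod (T F x - S x))\<^sup>2) \<partial>M) = (\<integral>\<^sup>+x. liminf (\<lambda>k. u k x) \<partial>M)"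
      proof (rule nn_integral_cong_AE)
        show "AE x in M. ennreal ((cmod (T F x - S x))\<^sup>2) = liminf (\<lambda>k. u k x)"
          using S
        proof eventually_elim
          case (elim x)
          then have "(\<lambda>k. u k x) \<longlonglongrightarrow> ennreal ((cmod (T F x - S x))\<^sup>2)"
            unfolding u_def by (intro tendsto_intros)
          then show ?case by (simp add: lim_imp_Liminf)
        qed
      qed
      also have "\<dots> \<le> liminf (\<lambda>k. \<integral>\<^sup>+x. u k x \<partial>M)"
        by (rule nn_integral_liminf) simp
      also have "\<dots> \<le> limsup (\<lambda>k. \<integral>\<^sup>+x. u k x \<partial>M)"
        by (rule Liminf_le_Limsup) simp
      also have "\<dots> \<le> ennreal (e\<^sup>2)"
      proof (rule Limsup_bounded)
        show "\<forall>\<^sub>F k in sequentially. (\<integral>\<^sup>+x. u k x \<partial>M) \<le> ennreal (e\<^sup>2)"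
          unfolding eventually_sequentially
        proof (intro exI[of _ N] allI impI)
          fix k assume "N \<le> k"
          then have "N \<le> r k" using seq_suble[OF r(1), of k] by simp
          let ?d = "\<lambda>x. T F x - T (box (r k)) x"
          have d: "in_L2 M ?d" by (rule in_L2_diff[OF T T])
          have lt: "L2_norm M ?d < e"
            using F N[OF \<open>N \<le> r k\<close>] by (intro F0(2)) (auto simp: box_def)
          have "(\<integral>\<^sup>+x. u k x \<partial>M) = ennreal (LINT x|M. (cmod (?d x))\<^sup>2)"
            unfolding u_def using d by (intro nn_integral_eq_integral) (auto simp: in_L2_def)
          also have "(LINT x|M. (cmod (?d x))\<^sup>2) = (L2_norm M ?d)\<^sup>2"
            by (simp add: L2_norm_def)
          also have "ennreal \<dots> \<le> ennreal (e\<^sup>2)"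
            using lt by (intro ennreal_leI power_mono) (auto simp: L2_norm_def)
          finally show "(\<integral>\<^sup>+x. u k x \<partial>M) \<le> ennreal (e\<^sup>2)" .
        qed
      qed
      finally have fin: "(\<integral>\<^sup>+x. ennreal ((cmod (T F x - S x))\<^sup>2) \<partial>M) \<le> ennreal (e\<^sup>2)" .
      have int: "integrable M (\<lambda>x. (cmod (T F x - S x))\<^sup>2)"
        by (rule integrableI_bounded) (use fin in \<open>auto simp: le_less_trans[OF _ ennreal_less_top]\<close>)
      have "ennreal (LINT x|M. (cmod (T F x - S x))\<^sup>2) \<le> ennreal (e\<^sup>2)"
        using fin nn_integral_eq_integral[OF int] by simp
      then have "(LINT x|M. (cmod (T F x - S x))\<^sup>2) \<le> e\<^sup>2"
        by (subst (asm) ennreal_le_iff) auto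
      with int e show ?thesis
        by (auto simp: in_L2_def L2_norm_def intro!: real_le_lsqrt)
    qed
    with F0(1) show ?thesis by blast
  qed

  have "has_L2_sum M g S"
    unfolding has_L2_sum_def
  proof (intro conjI allI g)
    obtain F where "in_L2 M (\<lambda>x. T F x - S x)" using close[of 1] by auto
    from in_L2_diff[OF T this, of F] show "in_L2 M S" by simp
    show "((\<lambda>F. L2_norm M (\<lambda>x. (\<Sum>n\<in>F. g n x) - S x)) \<longlongrightarrow> 0) (finite_subsets_at_top UNIV)"
    proof (rule tendstoI)
      fix e :: real assume "e > 0"
      from close[of "e / 2"] this obtain F0 where F0: "finite F0"
        "\<And>F. finite F \<Longrightarrow> F0 \<subseteq> F \<Longrightarrow> L2_norm M (\<lambda>x. T F x - S x) \<le> e / 2" by auto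
      have "dist (L2_norm M (\<lambda>x. T F x - S x)) 0 < e" if "finite F" "F0 \<subseteq> F" for F
      proof -
        have "0 \<le> L2_norm M (\<lambda>x. T F x - S x)" by (simp add: L2_norm_def)
        with F0(2)[OF that] \<open>e > 0\<close> show ?thesis by simp
      qed
      with F0(1) show "\<forall>\<^sub>F F in finite_subsets_at_top UNIV.
          dist (L2_norm M (\<lambda>x. (\<Sum>n\<in>F. g n x) - S x)) 0 < e"
        unfolding eventually_finite_subsets_at_top T_def by auto
    qed
  qed
  then show ?thesis by blast
qed

text \<open>By the reverse triangle inequality the norm is continuous, so bounds for finite sums
  pass to any sum of the series.\<close>

lemma has_L2_sum_norm_tendsto:
  assumes "has_L2_sum M g S"
  shows "((\<lambda>F. L2_norm M (\<lambda>x. \<Sum>n\<in>F. g n x)) \<longlongrightarrow> L2_norm M S) (finite_subsets_at_top UNIV)"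
proof (rule LIM_zero_cancel, rule Lim_null_comparison)
  show "((\<lambda>F. L2_norm M (\<lambda>x. (\<Sum>n\<in>F. g n x) - S x)) \<longlongrightarrow> 0) (finite_subsets_at_top UNIV)"
    using assms by (simp add: has_L2_sum_def)
  show "\<forall>\<^sub>F F in finite_subsets_at_top UNIV.
      norm (L2_norm M (\<lambda>x. \<Sum>n\<in>F. g n x) - L2_norm M S) \<le> L2_norm M (\<lambda>x. (\<Sum>n\<in>F. g n x) - S x)"
    using assms by (intro always_eventually allI)
      (auto simp: has_L2_sum_def intro!: abs_L2_norm_diff in_L2_sum)
qed

lemma ell2_norm_tendsto:
  assumes "a \<in> ell2"
  shows "((\<lambda>F. sqrt (\<Sum>n\<in>F. (cmod (a n))\<^sup>2)) \<longlongrightarrow> ell2_norm a) (finite_subsets_at_top UNIV)"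
  unfolding ell2_norm_def
  using has_sum_infsum[of "\<lambda>n. (cmod (a n))\<^sup>2" UNIV] assms
  by (intro tendsto_real_sqrt) (simp add: ell2_def has_sum_def)

section \<open>Second moments of the determinantal process\<close>

text \<open>For distinct points the determinant of order two gives the mixed moment. On the diagonal
  an indicator equals its square, giving variance \<open>\<sigma> - \<sigma> * \<sigma>\<close>;
  since \<open>K n n\<close> is \<open>\<sigma>\<close>, one formula covers both cases.\<close>

lemma occupation_covariance:
  assumes proc: "determinantal_process M K X" and diag: "\<And>n. K n n = of_real \<sigma>"
  shows "of_real (LINT \<omega>|M. (occupation X n \<omega> - \<sigma>) * (occupation X m \<omega> - \<sigma>)) =
    (if n = m then of_real \<sigma> else 0) - K n m * K m n"
proof -
  interpret prob_space M using proc by (simp add: determinantal_process_def)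
  let ?\<xi> = "occupation X"
  have [measurable]: "?\<xi> k \<in> borel_measurable M" for k
    using proc by (simp add: determinantal_process_def)
  have bnd: "\<bar>?\<xi> k \<omega>\<bar> \<le> 1" for k \<omega> by (simp add: occupation_def indicator_def)
  have int: "integrable M (?\<xi> k)" for k
    by (rule integrable_const_bound[where B = 1]) (use bnd in auto)
  have int2: "integrable M (\<lambda>\<omega>. ?\<xi> k \<omega> * ?\<xi> l \<omega>)" for k l
    by (rule integrable_const_bound[where B = 1])
      (use bnd in \<open>auto simp: abs_mult intro!: mult_le_one\<close>)
  have det: "complex_of_real (LINT \<omega>|M. (\<Prod>i<length ns. ?\<xi> (ns ! i) \<omega>)) =
      Determinant.det (Matrix.mat (length ns) (length ns) (\<lambda>(i, j). K (ns ! i) (ns ! j)))"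
    if "distinct ns" for ns
    using proc that by (simp add: determinantal_process_def)
  have E: "expectation (?\<xi> k) = \<sigma>" for k
    using det[of "[k]"] by (simp add: det_single diag)
  have E2: "of_real (LINT \<omega>|M. ?\<xi> n \<omega> * ?\<xi> m \<omega>) = of_real \<sigma> * of_real \<sigma> - K n m * K m n" if "n \<noteq> m"
    using det[of "[n, m]"] that det_mat_2[of "\<lambda>i j. K ([n, m] ! i) ([n, m] ! j)"]
    by (simp add: diag numeral_2_eq_2)
  have sq: "?\<xi> k \<omega> * ?\<xi> k \<omega> = ?\<xi> k \<omega>" for k \<omega> by (simp add: occupation_def indicator_def)
  have "(LINT \<omega>|M. (?\<xi> n \<omega> - \<sigma>) * (?\<xi> m \<omega> - \<sigma>)) =
      (LINT \<omega>|M. ?\<xi> n \<omega> * ?\<xi> m \<omega> - \<sigma> * ?\<xi> n \<omega> - \<sigma> * ?\<xi> m \<omega> + \<sigma> * \<sigma>)"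
    by (simp add: algebra_simps)
  also have "\<dots> = (LINT \<omega>|M. ?\<xi> n \<omega> * ?\<xi> m \<omega>) - \<sigma> * \<sigma>"
    using int int2 by (simp add: E prob_space)
  finally show ?thesis
    using E2 by (cases "n = m") (auto simp: sq E diag)
qed

lemma in_L2_centred_occupation:
  assumes "determinantal_process M K X"
  shows "in_L2 M (\<lambda>\<omega>. c * of_real (occupation X n \<omega> - \<sigma>))"
proof -
  interpret prob_space M using assms by (simp add: determinantal_process_def)
  have [measurable]: "occupation X n \<in> borel_measurable M"
    using assms by (simp add: determinantal_process_def)
  have "\<bar>occupation X n \<omega> - \<sigma>\<bar> \<le> 1 + \<bar>\<sigma>\<bar>" for \<omega>
    by (auto simp: occupation_def indicator_def)
  then have "(cmod (c * of_real (occupation X n \<omega> - \<sigma>)))\<^sup>2 \<le> (cmod c * (1 + \<bar>\<sigma>\<bar>))\<^sup>2" for \<omega>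
    unfolding norm_mult norm_of_real by (intro power_mono mult_left_mono) auto
  then have "integrable M (\<lambda>\<omega>. (cmod (c * of_real (occupation X n \<omega> - \<sigma>)))\<^sup>2)"
    by (intro integrable_const_bound[where B = "(cmod c * (1 + \<bar>\<sigma>\<bar>))\<^sup>2"]) auto
  then show ?thesis by (simp add: in_L2_def)
qed

text \<open>The squared modulus expands into covariances. Their diagonal part produces the sum of
  squares, and the rest is left in the shape of the Fourier quadratic form.\<close>

lemma occupation_second_moment:
  assumes proc: "determinantal_process M K X" and diag: "\<And>n. K n n = of_real \<sigma>" and F: "finite F"
  shows "of_real ((L2_norm M (\<lambda>\<omega>. \<Sum>n\<in>F. b n * of_real (occupation X n \<omega> - \<sigma>)))\<^sup>2) =
    of_real (\<sigma> * (\<Sum>n\<in>F. (cmod (b n))\<^sup>2)) - (\<Sum>n\<in>F. \<Sum>m\<in>F. b n * cnj (b m) * (K n m * K m n))"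
proof -
  interpret prob_space M using proc by (simp add: determinantal_process_def)
  let ?\<eta> = "\<lambda>n \<omega>. occupation X n \<omega> - \<sigma>"
  have [measurable]: "occupation X n \<in> borel_measurable M" for n
    using proc by (simp add: determinantal_process_def)
  have bnd: "\<bar>?\<eta> n \<omega>\<bar> \<le> 1 + \<bar>\<sigma>\<bar>" for n \<omega>
    by (auto simp: occupation_def indicator_def)
  have int: "integrable M (\<lambda>\<omega>. ?\<eta> n \<omega> * ?\<eta> m \<omega>)" for n m
    by (rule integrable_const_bound[where B = "(1 + \<bar>\<sigma>\<bar>) * (1 + \<bar>\<sigma>\<bar>)"])
      (use bnd in \<open>auto simp: abs_mult intro!: mult_mono\<close>)
  have "of_real ((L2_norm M (\<lambda>\<omega>. \<Sum>n\<in>F. b n * of_real (?\<eta> n \<omega>)))\<^sup>2) =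
      (LINT \<omega>|M. complex_of_real ((cmod (\<Sum>n\<in>F. b n * of_real (?\<eta> n \<omega>)))\<^sup>2))"
    unfolding integral_complex_of_real by (simp add: L2_norm_def)
  also have "\<dots> = (LINT \<omega>|M. (\<Sum>n\<in>F. \<Sum>m\<in>F. b n * cnj (b m) * of_real (?\<eta> n \<omega> * ?\<eta> m \<omega>)))"
    unfolding complex_norm_square by (simp add: sum_product mult_ac)
  also have "\<dots> = (\<Sum>n\<in>F. \<Sum>m\<in>F. b n * cnj (b m) * of_real (LINT \<omega>|M. ?\<eta> n \<omega> * ?\<eta> m \<omega>))"
    using int by (simp del: of_real_mult of_real_diff)
  also have "\<dots> = (\<Sum>n\<in>F. \<Sum>m\<in>F. (if n = m then of_real \<sigma> * (b n * cnj (b n)) else 0) -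
      b n * cnj (b m) * (K n m * K m n))"
    unfolding occupation_covariance[OF proc diag] by (intro sum.cong refl) (auto simp: algebra_simps)
  also have "\<dots> = of_real (\<sigma> * (\<Sum>n\<in>F. (cmod (b n))\<^sup>2)) -
      (\<Sum>n\<in>F. \<Sum>m\<in>F. b n * cnj (b m) * (K n m * K m n))"
    using F unfolding sum_subtractf
    by (simp add: sum.delta sum_distrib_left complex_norm_square del: of_real_power)
  finally show ?thesis .
qed

section \<open>Bounds for the quadratic form and positivity of the lower constant\<close>

lemma quadratic_form_bounds:
  assumes f: "f \<in> borel_measurable circle" "\<And>t. t \<in> space circle \<Longrightarrow> f t \<in> {0..1}" and F: "finite F"
  obtains q where
    "of_real q = (\<Sum>n\<in>F. \<Sum>m\<in>F. b n * cnj (b m) * (fourier_coeff f (n - m) * fourier_coeff f (m - n)))"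
    "0 \<le> q" "q \<le> (LINT t|circle. (f t)\<^sup>2) * (\<Sum>n\<in>F. (cmod (b n))\<^sup>2)"
proof
  define P where "P u = (cmod (\<Sum>n\<in>F. b n * circle_char (- n) u))\<^sup>2" for u
  let ?C = "circle \<Otimes>\<^sub>M circle"
  \<comment> \<open>Realizing the complex double sum as a real integral shows that it is real; the
    integrand is nonnegative, which settles the sign.\<close>
  define q where "q = (LINT p|?C. f (fst p) * f (snd p) * P (fst p - snd p))"
  have [measurable]: "f \<in> borel_measurable circle" by fact
  have f1: "\<bar>f t\<bar> \<le> 1" "\<bar>(f t)\<^sup>2\<bar> \<le> 1" if "t \<in> space circle" for t
    using f(2)[OF that] by (auto simp: power_le_one)
  note form = fourier_quadratic_form[where F = F and b = b, folded P_def]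
  have ff: "integrable ?C (\<lambda>p. f (fst p) * f (snd p) * P (fst p - snd p))"
    by (intro form(1)) (use f1 in auto)
  show "of_real q = (\<Sum>n\<in>F. \<Sum>m\<in>F. b n * cnj (b m) * (fourier_coeff f (n - m) * fourier_coeff f (m - n)))"
    unfolding q_def by (intro form(2)) (use f1 in auto)
  have nn: "0 \<le> f (fst p)" "0 \<le> f (snd p)" if "p \<in> space ?C" for p
    using that f(2) by (auto simp: space_pair_measure)
  have P: "0 \<le> P u" for u by (simp add: P_def)
  show "0 \<le> q"
    unfolding q_def by (intro Bochner_Integration.integral_nonneg) (auto simp: nn P)
  define I where "I = (LINT t|circle. (f t)\<^sup>2)"
  define N where "N = (\<Sum>n\<in>F. (cmod (b n))\<^sup>2)"
  have delta: "(\<Sum>n\<in>F. \<Sum>m\<in>F. if n = m then of_real I * (b n * cnj (b n)) else 0) = of_real (I * N)"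
    using F by (simp add: N_def sum_distrib_left complex_norm_square del: of_real_power)
  \<comment> \<open>The factor 1 is the second function in \<open>form\<close>. Its coefficients
    vanish off the diagonal, so only the mean \<open>I\<close> of the squared \<open>f\<close> times
    \<open>N\<close> survives; \<open>i2\<close> and \<open>e2\<close> exchange the two
    variables.\<close>
  have i1: "integrable ?C (\<lambda>p. (f (fst p))\<^sup>2 * 1 * P (fst p - snd p))"
    by (intro form(1)) (use f1 in auto)
  have "of_real (LINT p|?C. (f (fst p))\<^sup>2 * 1 * P (fst p - snd p)) =
      (\<Sum>n\<in>F. \<Sum>m\<in>F. b n * cnj (b m) * (fourier_coeff (\<lambda>t. (f t)\<^sup>2) (n - m) * fourier_coeff (\<lambda>_. 1) (m - n)))"
    by (intro form(2)) (use f1 in auto)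
  also have "\<dots> = (\<Sum>n\<in>F. \<Sum>m\<in>F. if n = m then of_real I * (b n * cnj (b n)) else 0)"
    by (intro sum.cong refl) (auto simp: fourier_coeff_1 fourier_coeff_0 I_def)
  finally have e1: "(LINT p|?C. (f (fst p))\<^sup>2 * 1 * P (fst p - snd p)) = I * N"
    unfolding delta of_real_eq_iff .
  have i2: "integrable ?C (\<lambda>p. 1 * (f (snd p))\<^sup>2 * P (fst p - snd p))"
    by (intro form(1)) (use f1 in auto)
  have "of_real (LINT p|?C. 1 * (f (snd p))\<^sup>2 * P (fst p - snd p)) =
      (\<Sum>n\<in>F. \<Sum>m\<in>F. b n * cnj (b m) * (fourier_coeff (\<lambda>_. 1) (n - m) * fourier_coeff (\<lambda>t. (f t)\<^sup>2) (m - n)))"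
    by (intro form(2)) (use f1 in auto)
  also have "\<dots> = (\<Sum>n\<in>F. \<Sum>m\<in>F. if n = m then of_real I * (b n * cnj (b n)) else 0)"
    by (intro sum.cong refl) (auto simp: fourier_coeff_1 fourier_coeff_0 I_def)
  finally have e2: "(LINT p|?C. 1 * (f (snd p))\<^sup>2 * P (fst p - snd p)) = I * N"
    unfolding delta of_real_eq_iff .
  have "q \<le> (LINT p|?C. ((f (fst p))\<^sup>2 * 1 * P (fst p - snd p) +
      1 * (f (snd p))\<^sup>2 * P (fst p - snd p)) / 2)"
    unfolding q_def
  proof (intro integral_mono ff)
    show "integrable ?C (\<lambda>p. ((f (fst p))\<^sup>2 * 1 * P (fst p - snd p) +
        1 * (f (snd p))\<^sup>2 * P (fst p - snd p)) / 2)"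
      using i1 i2 by (intro integrable_divide_zero Bochner_Integration.integrable_add) auto
    fix p
    have "f (fst p) * f (snd p) \<le> ((f (fst p))\<^sup>2 + (f (snd p))\<^sup>2) / 2"
      using sum_squares_bound[of "f (fst p)" "f (snd p)"] by simp
    from mult_right_mono[OF this P[of "fst p - snd p"]]
    show "f (fst p) * f (snd p) * P (fst p - snd p) \<le> ((f (fst p))\<^sup>2 * 1 * P (fst p - snd p) +
        1 * (f (snd p))\<^sup>2 * P (fst p - snd p)) / 2"
      by (simp add: algebra_simps)
  qed
  also have "\<dots> = I * N"
    using e1 e2 Bochner_Integration.integral_add[OF i1 i2] by simp
  finally show "q \<le> (LINT t|circle. (f t)\<^sup>2) * (\<Sum>n\<in>F. (cmod (b n))\<^sup>2)"
    by (simp add: I_def N_def)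
qed

text \<open>The integrand is nonnegative, so its integral vanishes exactly when \<open>f\<close> is
  almost everywhere 0 or 1; the level set where \<open>f\<close> equals 1 is then the required Borel
  set.\<close>

lemma lower_const_pos_iff:
  assumes f: "f \<in> borel_measurable circle" "\<And>t. t \<in> space circle \<Longrightarrow> f t \<in> {0..1}"
  shows "lower_const f > 0 \<longleftrightarrow> \<not> is_indicator_ae f"
proof -
  have [measurable]: "f \<in> borel_measurable circle" by fact
  have nn: "0 \<le> f t * (1 - f t)" if "t \<in> space circle" for t using f(2)[OF that] by simp
  have int: "integrable circle (\<lambda>t. f t * (1 - f t))"
    by (rule integrable_circle_bounded[where B = 1])
      (use f(2) in \<open>auto simp: abs_mult intro!: mult_le_one\<close>)
  have "lower_const f > 0 \<longleftrightarrow> (LINT t|circle. f t * (1 - f t)) \<noteq> 0"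
    using Bochner_Integration.integral_nonneg[of circle "\<lambda>t. f t * (1 - f t)", OF nn]
    by (auto simp: lower_const_def less_le)
  also have "\<dots> \<longleftrightarrow> \<not> (AE t in circle. f t * (1 - f t) = 0)"
    using int nn by (subst integral_nonneg_eq_0_iff_AE) auto
  also have "(AE t in circle. f t * (1 - f t) = 0) \<longleftrightarrow> is_indicator_ae f"
  proof
    assume *: "AE t in circle. f t * (1 - f t) = 0"
    have "{t \<in> space circle. f t = 1} \<in> sets circle" by measurable
    moreover have "AE t in circle. f t = indicator {t \<in> space circle. f t = 1} t"
      using * AE_space by eventually_elim (auto simp: indicator_def)
    ultimately show "is_indicator_ae f" unfolding is_indicator_ae_def by blast
  next
    assume "is_indicator_ae f"
    then show "AE t in circle. f t * (1 - f t) = 0"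
      unfolding is_indicator_ae_def by (auto elim!: eventually_mono simp: indicator_def)
  qed
  finally show ?thesis .
qed

section \<open>The two-sided inequality for square-summable coefficients\<close>

theorem theorem4p1:
  fixes f :: "real \<Rightarrow> real" and \<sigma> :: real
    and M :: "'o measure" and X :: "'o \<Rightarrow> int set" and \<xi> :: "int \<Rightarrow> 'o \<Rightarrow> real"
  assumes f_borel: "f \<in> borel_measurable circle"
    and f_range: "\<forall>t\<in>space circle. f t \<in> {0..1}"
    and sigma: "\<sigma> = (LINT t|circle. f t)"
    and sigma_range: "\<sigma> \<in> {0<..<1}"
    and process: "determinantal_process M (toeplitz_kernel f) X"
    and xi: "\<xi> = occupation X"
  shows
    "(\<forall>a\<in>ell2.
        (\<exists>S. has_L2_sum M (\<lambda>n \<omega>. a n * of_real (\<xi> n \<omega> - \<sigma>)) S) \<and>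
        (\<forall>S. has_L2_sum M (\<lambda>n \<omega>. a n * of_real (\<xi> n \<omega> - \<sigma>)) S \<longrightarrow>
             L2_norm M S \<le> sqrt \<sigma> * ell2_norm a)) \<and>
     (\<not> is_indicator_ae f \<longrightarrow>
        (\<forall>a\<in>ell2. \<forall>S. has_L2_sum M (\<lambda>n \<omega>. a n * of_real (\<xi> n \<omega> - \<sigma>)) S \<longrightarrow>
             lower_const f * ell2_norm a \<le> L2_norm M S)) \<and>
     (lower_const f > 0 \<longleftrightarrow> \<not> is_indicator_ae f)"
proof -
  have f: "\<And>t. t \<in> space circle \<Longrightarrow> f t \<in> {0..1}" using f_range by blast
  interpret prob_space M using process by (simp add: determinantal_process_def)
  have [measurable]: "f \<in> borel_measurable circle" by fact
  have f_int: "integrable circle f" "integrable circle (\<lambda>t. (f t)\<^sup>2)"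
    by (rule integrable_circle_bounded[where B = 1]; use f in \<open>auto simp: power_le_one\<close>)+
  \<comment> \<open>This identifies what remains of \<open>\<sigma>\<close> after the upper bound
    for \<open>q\<close> is subtracted: the square of the lower constant.\<close>
  have c: "(LINT t|circle. f t * (1 - f t)) = \<sigma> - (LINT t|circle. (f t)\<^sup>2)"
    using f_int by (simp add: sigma algebra_simps power2_eq_square)
  have c_nn: "0 \<le> (LINT t|circle. f t * (1 - f t))"
    by (intro Bochner_Integration.integral_nonneg) (use f in auto)
  define N where "N a F = (\<Sum>n\<in>F. (cmod (a n))\<^sup>2)" for a :: "int \<Rightarrow> complex" and F
  define L where "L a F = L2_norm M (\<lambda>\<omega>. \<Sum>n\<in>F. a n * of_real (\<xi> n \<omega> - \<sigma>))" for a F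
  have bounds: "lower_const f * sqrt (N a F) \<le> L a F \<and> L a F \<le> sqrt \<sigma> * sqrt (N a F)"
    if F: "finite F" for a F
  proof -
    obtain q where q: "of_real q =
        (\<Sum>n\<in>F. \<Sum>m\<in>F. a n * cnj (a m) * (fourier_coeff f (n - m) * fourier_coeff f (m - n)))"
      "0 \<le> q" "q \<le> (LINT t|circle. (f t)\<^sup>2) * N a F"
      unfolding N_def by (rule quadratic_form_bounds[OF f_borel f F])
    have "toeplitz_kernel f n n = of_real \<sigma>" for n
      by (simp add: toeplitz_kernel_def fourier_coeff_0 sigma)
    from occupation_second_moment[OF process this F, of a]
    have "complex_of_real ((L a F)\<^sup>2) = of_real (\<sigma> * N a F - q)"
      unfolding toeplitz_kernel_def q(1)[symmetric] L_def N_def xi by simp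
    then have L2: "(L a F)\<^sup>2 = \<sigma> * N a F - q" unfolding of_real_eq_iff .
    have "L a F \<ge> 0" by (simp add: L_def L2_norm_def)
    moreover have "(L a F)\<^sup>2 \<le> \<sigma> * N a F" using L2 q(2) by simp
    moreover have "(LINT t|circle. f t * (1 - f t)) * N a F \<le> (L a F)\<^sup>2"
      using L2 q(3) unfolding c by (simp add: algebra_simps)
    \<comment> \<open>Each product of roots is folded into a single root, so comparing squares
      suffices.\<close>
    ultimately show ?thesis
      unfolding lower_const_def real_sqrt_mult[symmetric] by (auto intro: real_le_rsqrt real_le_lsqrt)
  qed
  have ex: "\<exists>S. has_L2_sum M (\<lambda>n \<omega>. a n * of_real (\<xi> n \<omega> - \<sigma>)) S" if a: "a \<in> ell2" for a
  \<comment> \<open>The weights come from the upper bound for finite sums, which thus provides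
    convergence.\<close>
  proof (rule has_L2_sum_exists[where w = "\<lambda>n. \<sigma> * (cmod (a n))\<^sup>2"])
    show "in_L2 M (\<lambda>\<omega>. a n * of_real (\<xi> n \<omega> - \<sigma>))" for n
      unfolding xi by (rule in_L2_centred_occupation[OF process])
    show "(\<lambda>n. \<sigma> * (cmod (a n))\<^sup>2) summable_on UNIV"
      using a by (intro summable_on_cmult_right) (simp add: ell2_def)
    show "L2_norm M (\<lambda>\<omega>. \<Sum>n\<in>F. a n * of_real (\<xi> n \<omega> - \<sigma>)) \<le> sqrt (\<Sum>n\<in>F. \<sigma> * (cmod (a n))\<^sup>2)"
      if "finite F" for F
      using bounds[OF that, of a] by (simp add: L_def N_def real_sqrt_mult flip: sum_distrib_left)
  qed
  have lim: "L2_norm M S \<le> sqrt \<sigma> * ell2_norm a" "lower_const f * ell2_norm a \<le> L2_norm M S"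
    if a: "a \<in> ell2" and S: "has_L2_sum M (\<lambda>n \<omega>. a n * of_real (\<xi> n \<omega> - \<sigma>)) S" for a S
  proof -
    have ev: "\<forall>\<^sub>F F in finite_subsets_at_top UNIV.
        lower_const f * sqrt (N a F) \<le> L a F \<and> L a F \<le> sqrt \<sigma> * sqrt (N a F)"
      using bounds by (intro eventually_finite_subsets_at_top_weakI) auto
    note L = has_L2_sum_norm_tendsto[OF S, folded L_def]
    note N = tendsto_mult[OF tendsto_const ell2_norm_tendsto[OF a, folded N_def]]
    show "L2_norm M S \<le> sqrt \<sigma> * ell2_norm a"
      by (rule tendsto_le[OF _ N L]) (use ev in \<open>auto elim: eventually_mono\<close>)
    show "lower_const f * ell2_norm a \<le> L2_norm M S"
      by (rule tendsto_le[OF _ L N]) (use ev in \<open>auto elim: eventually_mono\<close>)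
  qed
  show ?thesis
    using ex lim lower_const_pos_iff[OF f_borel f] by blast
qed

end
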